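(* Let $R$ be a Noetherian pre-Prüfer ring. Then $\dim(R)\leq 1$.
   Context: All rings are commutative with identity; $\dim$ denotes Krull dimension. An ideal is regular if it contains a non-zero-divisor. A ring is a Prüfer ring if every finitely generated regular ideal is invertible (in its total ring of fractions). A ring $R$ is a pre-Prüfer ring if $R/\mathfrak a$ is a Prüfer ring for every ideal $\mathfrak a$ of $R$ with $\mathfrak a\neq 0$ and $\mathfrak a\neq R$. *)

theory Defs
  imports "HOL-Algebra.Module" "HOL-Algebra.Ideal_Product" "HOL-Algebra.Ring_Divisibility"
    "HOL-Library.Extended_Real"
begin

definition nonzerodivisors :: "('a, 'b) ring_scheme \<Rightarrow> 'a set" where
  "nonzerodivisors R =
     {s \<in> carrier R. \<forall>x \<in> carrier R. s \<otimes>\<^bsub>R\<^esub> x = \<zero>\<^bsub>R\<^esub> \<longrightarrow> x = \<zero>\<^bsub>R\<^esub>}"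

definition regular_ideal :: "'a set \<Rightarrow> ('a, 'b) ring_scheme \<Rightarrow> bool" where
  "regular_ideal I R \<longleftrightarrow> ideal I R \<and> I \<inter> nonzerodivisors R \<noteq> {}"

definition fin_gen_ideal :: "'a set \<Rightarrow> ('a, 'b) ring_scheme \<Rightarrow> bool" where
  "fin_gen_ideal I R \<longleftrightarrow> (\<exists>A \<subseteq> carrier R. finite A \<and> I = Idl\<^bsub>R\<^esub> A)"

text \<open>
  Two fractions a/s and b/t are identified when at = bs; as the denominators are
  non-zero-divisors, no further factor is needed to make this transitive.
\<close>

definition fraction_rel :: "('a, 'b) ring_scheme \<Rightarrow> (('a \<times> 'a) \<times> ('a \<times> 'a)) set" where
  "fraction_rel R =
     {((a, s), (b, t)). a \<in> carrier R \<and> s \<in> nonzerodivisors R \<and>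
        b \<in> carrier R \<and> t \<in> nonzerodivisors R \<and> a \<otimes>\<^bsub>R\<^esub> t = b \<otimes>\<^bsub>R\<^esub> s}"

definition fraction :: "('a, 'b) ring_scheme \<Rightarrow> 'a \<Rightarrow> 'a \<Rightarrow> ('a \<times> 'a) set" where
  "fraction R a s = fraction_rel R `` {(a, s)}"

text \<open>
  The total ring of fractions, as an algebra over the base ring. In the sums and products the
  classes being united are all equal, since the formulas do not depend on the representatives.
\<close>

definition total_fractions :: "('a, 'b) ring_scheme \<Rightarrow> ('a, ('a \<times> 'a) set) module" where
  "total_fractions R =
     \<lparr>carrier = (carrier R \<times> nonzerodivisors R) // fraction_rel R,
      monoid.mult = (\<lambda>U V. \<Union>(a, s)\<in>U. \<Union>(b, t)\<in>V. fraction R (a \<otimes>\<^bsub>R\<^esub> b) (s \<otimes>\<^bsub>R\<^esub> t)),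
      one = fraction R \<one>\<^bsub>R\<^esub> \<one>\<^bsub>R\<^esub>,
      zero = fraction R \<zero>\<^bsub>R\<^esub> \<one>\<^bsub>R\<^esub>,
      add = (\<lambda>U V. \<Union>(a, s)\<in>U. \<Union>(b, t)\<in>V.
               fraction R (a \<otimes>\<^bsub>R\<^esub> t \<oplus>\<^bsub>R\<^esub> b \<otimes>\<^bsub>R\<^esub> s) (s \<otimes>\<^bsub>R\<^esub> t)),
      smult = (\<lambda>r U. \<Union>(a, s)\<in>U. fraction R (r \<otimes>\<^bsub>R\<^esub> a) s)\<rparr>"

definition fraction_embed :: "('a, 'b) ring_scheme \<Rightarrow> 'a \<Rightarrow> ('a \<times> 'a) set" where
  "fraction_embed R a = fraction R a \<one>\<^bsub>R\<^esub>"

text \<open>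
  I is invertible if I J = R for some R-submodule J of the total ring of fractions, with I and R
  viewed inside it. The library's \<open>ideal_prod\<close> is used for the product of submodules: it only
  forms finite sums of products and does not require its arguments to be ideals.
\<close>

definition invertible_ideal :: "'a set \<Rightarrow> ('a, 'b) ring_scheme \<Rightarrow> bool" where
  "invertible_ideal I R \<longleftrightarrow> ideal I R \<and>
     (\<exists>J. submodule J R (total_fractions R) \<and>
       (fraction_embed R ` I) \<cdot>\<^bsub>total_fractions R\<^esub> J = fraction_embed R ` carrier R)"

locale pruefer_ring = cring +
  assumes fin_gen_regular_invertible:
    "\<lbrakk>fin_gen_ideal I R; regular_ideal I R\<rbrakk> \<Longrightarrow> invertible_ideal I R"

locale pre_pruefer_ring = cring +
  assumes quotient_pruefer:
    "\<lbrakk>ideal I R; I \<noteq> {\<zero>}; I \<noteq> carrier R\<rbrakk> \<Longrightarrow> pruefer_ring (R Quot I)"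

text \<open>
  The supremum of the lengths of chains of prime ideals, where a chain with n + 1 members has
  length n. For the zero ring this is the supremum of the empty set, which is minus infinity.
\<close>

definition krull_dim :: "('a, 'b) ring_scheme \<Rightarrow> ereal" where
  "krull_dim R =
     Sup {ereal (real n) | n. \<exists>P. (\<forall>i\<le>n. primeideal (P i) R) \<and> (\<forall>i<n. P i \<subset> P (Suc i))}"

end

theory Submission
  imports Defs
begin

text \<open>
  A dimension above one means strict inclusions of primes \<open>P0 \<subset> P \<subset> M\<close>. Let \<open>Q\<close> be the symbolic
  square of \<open>P\<close>, the set of all \<open>x\<close> with \<open>s x \<in> P\<^sup>2\<close> for some \<open>s \<notin> P\<close>. The inclusion \<open>P \<subset> M\<close> forces
  \<open>P = Q\<close>, and this contradicts \<open>P0 \<subset> P\<close>: the equation \<open>P = Q\<close> says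
  that \<open>P = P\<^sup>2\<close> after localizing at \<open>P\<close>; by Nakayama's lemma \<open>P\<close> then vanishes locally, hence
  lies in every prime below it (\<open>symbolic_square_imp_minimal_prime\<close>).

  The equality \<open>P = Q\<close> comes from the quotient by \<open>Q\<close>, which is a Pruefer ring unless \<open>Q = 0\<close>; and if
  \<open>Q = 0\<close>, then \<open>P\<^sup>2 = 0 \<subseteq> P0\<close>, so \<open>P \<subseteq> P0\<close> outright. The ideal \<open>Q\<close> is \<open>P\<close>-primary, so an element \<open>b\<close>
  of \<open>M\<close> outside \<open>P\<close> is a non-zero-divisor modulo \<open>Q\<close>. For every \<open>p \<in> P\<close> the regular ideal \<open>(p, b)\<close>
  is therefore invertible modulo \<open>Q\<close>, and locally at \<open>M\<close> one of its two generators divides the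
  other (\<open>invertible_pair\<close>). It cannot be \<open>p\<close> that divides \<open>b\<close>, as \<open>b \<notin> P\<close>. So \<open>b\<close> divides \<open>p\<close>, and
  the quotient again lies in \<open>P\<close>. Thus \<open>P = M P + Q\<close> locally at \<open>M\<close>, and Nakayama's lemma gives
  \<open>P = Q\<close> locally at \<open>M\<close>, hence in \<open>R\<close> because \<open>Q\<close> is \<open>P\<close>-primary
  (\<open>pruefer_mod_symbolic_square\<close>).

  Localizations are replaced by contractions from them: \<open>saturation R M K\<close> is the preimage in \<open>R\<close>
  of the extension of \<open>K\<close> to the local ring at \<open>M\<close>, and a local inclusion \<open>N \<subseteq> K\<close> is expressed as
  \<open>N \<subseteq> saturation R M K\<close>.
\<close>

section \<open>Saturation at a prime ideal\<close>

definition saturation :: "('a, 'b) ring_scheme \<Rightarrow> 'a set \<Rightarrow> 'a set \<Rightarrow> 'a set" where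
  "saturation R M K = {x \<in> carrier R. \<exists>s \<in> carrier R - M. s \<otimes>\<^bsub>R\<^esub> x \<in> K}"

context cring
begin

lemma saturation_ideal:
  assumes M: "primeideal M R" and K: "ideal K R"
  shows "ideal (saturation R M K) R"
proof -
  interpret M: primeideal M R by fact
  interpret K: ideal K R by fact
  show ?thesis
  proof (rule idealI)
    show "ring R" by (rule ring_axioms)
    show "subgroup (saturation R M K) (add_monoid R)"
    proof (rule add.subgroupI)
      show "saturation R M K \<subseteq> carrier R" by (auto simp: saturation_def)
      have "\<one> \<notin> M" using M.I_notcarr M.one_imp_carrier by auto
      then have "\<zero> \<in> saturation R M K" by (auto simp: saturation_def intro!: bexI[of _ \<one>])
      then show "saturation R M K \<noteq> {}" by auto
    next
      fix a assume "a \<in> saturation R M K"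
      then obtain s where s: "a \<in> carrier R" "s \<in> carrier R - M" "s \<otimes> a \<in> K"
        by (auto simp: saturation_def)
      then have "s \<otimes> (\<ominus> a) \<in> K" by (simp add: r_minus)
      with s show "\<ominus> a \<in> saturation R M K" by (auto simp: saturation_def)
    next
      fix a b assume "a \<in> saturation R M K" "b \<in> saturation R M K"
      then obtain s t where s: "a \<in> carrier R" "s \<in> carrier R - M" "s \<otimes> a \<in> K"
        and t: "b \<in> carrier R" "t \<in> carrier R - M" "t \<otimes> b \<in> K"
        by (auto simp: saturation_def)
      have st: "s \<otimes> t \<in> carrier R - M" using s t M.I_prime by auto
      have "s \<otimes> t \<otimes> (a \<oplus> b) = t \<otimes> (s \<otimes> a) \<oplus> s \<otimes> (t \<otimes> b)"
        using s t by (simp add: r_distr m_ac)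
      also have "\<dots> \<in> K" using s t by (simp add: K.I_l_closed)
      finally show "a \<oplus> b \<in> saturation R M K" using s t st by (auto simp: saturation_def)
    qed
  next
    fix a x assume a: "a \<in> saturation R M K" and x: "x \<in> carrier R"
    then obtain s where s: "a \<in> carrier R" "s \<in> carrier R - M" "s \<otimes> a \<in> K"
      by (auto simp: saturation_def)
    have "s \<otimes> (x \<otimes> a) = x \<otimes> (s \<otimes> a)" using s x by (simp add: m_ac)
    also have "\<dots> \<in> K" using s x by (simp add: K.I_l_closed)
    finally show "x \<otimes> a \<in> saturation R M K" using s x by (auto simp: saturation_def)
    then show "a \<otimes> x \<in> saturation R M K" using s x by (simp add: m_comm)
  qed
qed

lemma subset_saturation:
  assumes M: "primeideal M R" and K: "ideal K R"
  shows "K \<subseteq> saturation R M K"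
proof -
  interpret M: primeideal M R by fact
  interpret K: ideal K R by fact
  have "\<one> \<notin> M" using M.I_notcarr M.one_imp_carrier by auto
  then show ?thesis by (auto simp: saturation_def intro!: bexI[of _ \<one>])
qed

lemma saturation_mono: "K \<subseteq> L \<Longrightarrow> saturation R M K \<subseteq> saturation R M L"
  by (auto simp: saturation_def)

lemma saturation_idem:
  assumes M: "primeideal M R"
  shows "saturation R M (saturation R M K) \<subseteq> saturation R M K"
proof
  interpret M: primeideal M R by fact
  fix x assume "x \<in> saturation R M (saturation R M K)"
  then obtain s t where s: "x \<in> carrier R" "s \<in> carrier R - M" "t \<in> carrier R - M"
    and "t \<otimes> (s \<otimes> x) \<in> K" by (auto simp: saturation_def)
  then have "t \<otimes> s \<in> carrier R - M" "t \<otimes> s \<otimes> x \<in> K" using M.I_prime by (auto simp: m_assoc)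
  with s show "x \<in> saturation R M K" unfolding saturation_def by blast
qed

lemma saturation_primeideal:
  assumes P: "primeideal P R" and "P \<subseteq> M"
  shows "saturation R M P \<subseteq> P"
  using primeideal.I_prime[OF P] assms(2) by (auto simp: saturation_def)

text \<open>The saturation of \<open>P\<^sup>2\<close> at \<open>P\<close> is the symbolic square of \<open>P\<close>.\<close>

lemma symbolic_square_subset:
  assumes P: "primeideal P R"
  shows "saturation R P (P \<cdot> P) \<subseteq> P"
  using ideal_prod_inter[OF primeideal.axioms(1)[OF P] primeideal.axioms(1)[OF P]]
    saturation_mono[of "P \<cdot> P" P P] saturation_primeideal[OF P, of P] by auto

lemma ideal_prod_subset_prime:
  assumes P: "primeideal P R" and I: "ideal I R" and "I \<cdot> I \<subseteq> P"
  shows "I \<subseteq> P"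
proof
  fix x assume x: "x \<in> I"
  then have "x \<otimes> x \<in> P" using assms(3) ideal_prod.prod by fastforce
  moreover have "x \<in> carrier R" using x ideal.Icarr[OF I] by auto
  ultimately show "x \<in> P" using primeideal.I_prime[OF P] by auto
qed

lemma ideal_prod_cgenideal:
  assumes I: "ideal I R" and a: "a \<in> carrier R" and w: "w \<in> I \<cdot> (PIdl a)"
  shows "\<exists>i\<in>I. w = i \<otimes> a"
proof -
  interpret I: ideal I R by fact
  show ?thesis using w
  proof (induction rule: ideal_prod.induct)
    case (prod i j)
    then obtain r where "r \<in> carrier R" "j = r \<otimes> a" by (auto simp: cgenideal_def)
    with prod a show ?case by (auto intro!: bexI[of _ "i \<otimes> r"] simp: m_assoc I.I_r_closed)
  next
    case (sum v w)
    then obtain i j where "i \<in> I" "j \<in> I" "v = i \<otimes> a" "w = j \<otimes> a" by auto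
    then show ?case using a by (auto intro!: bexI[of _ "i \<oplus> j"] simp: l_distr)
  qed
qed

lemma set_add_subset_ideal:
  assumes "ideal L R" "I \<subseteq> L" "J \<subseteq> L"
  shows "I <+>\<^bsub>R\<^esub> J \<subseteq> L"
  using assms additive_subgroup.a_closed[OF ideal.axioms(1)[OF assms(1)]]
  by (auto simp: set_add_def')

lemma subset_set_add:
  assumes I: "ideal I R" and J: "ideal J R"
  shows "I \<subseteq> I <+>\<^bsub>R\<^esub> J" "J \<subseteq> I <+>\<^bsub>R\<^esub> J"
proof -
  interpret I: ideal I R by fact
  interpret J: ideal J R by fact
  have "x \<oplus> \<zero> \<in> I <+>\<^bsub>R\<^esub> J" if "x \<in> I" for x
    unfolding set_add_def' using that J.zero_closed by blast
  then show "I \<subseteq> I <+>\<^bsub>R\<^esub> J" by auto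
  have "\<zero> \<oplus> x \<in> I <+>\<^bsub>R\<^esub> J" if "x \<in> J" for x
    unfolding set_add_def' using that I.zero_closed by blast
  then show "J \<subseteq> I <+>\<^bsub>R\<^esub> J" by auto
qed

text \<open>
  Nakayama's lemma for the localization at \<open>M\<close>. Instead of a determinant or an induction on
  generators, the ascending chain condition is used: among the saturated ideals above \<open>Q\<close> that do
  not contain \<open>N\<close> there would be a maximal one \<open>K\<close>. Adding any \<open>a \<in> N - K\<close> to \<open>K\<close> captures \<open>N\<close>
  locally, so the module \<open>N\<close> modulo \<open>K\<close> is locally generated by the single element \<open>a\<close>, where
  \<open>s a = i a\<close> with \<open>s \<notin> M\<close> and \<open>i \<in> M\<close> forces \<open>a = 0\<close> at once.
\<close>

lemma local_nakayama:
  assumes noeth: "noetherian_ring R"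
    and M: "primeideal M R" and I: "ideal I R" and N: "ideal N R" and Q: "ideal Q R"
    and IM: "I \<subseteq> M" and NS: "N \<subseteq> saturation R M ((I \<cdot> N) <+>\<^bsub>R\<^esub> Q)"
  shows "N \<subseteq> saturation R M Q"
proof (rule ccontr)
  assume contra: "\<not> N \<subseteq> saturation R M Q"
  interpret M: primeideal M R by fact
  interpret I: ideal I R by fact
  interpret N: ideal N R by fact
  define S where "S = {K. ideal K R \<and> saturation R M K \<subseteq> K \<and> Q \<subseteq> K \<and> \<not> N \<subseteq> K}"
  have start: "saturation R M Q \<in> S"
    unfolding S_def using contra M Q saturation_ideal saturation_idem subset_saturation by auto
  have "\<exists>K\<in>S. \<forall>X\<in>S. K \<subseteq> X \<longrightarrow> X = K"
  proof (rule subset_Zorn)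
    fix C assume C: "subset.chain S C"
    show "\<exists>U\<in>S. \<forall>X\<in>C. X \<subseteq> U"
    proof (cases "C = {}")
      case True then show ?thesis using start by auto
    next
      case False
      have "subset.chain {I. ideal I R} C"
        using C by (auto simp: S_def pred_on.chain_def)
      then have "\<Union>C \<in> C" using noetherian_ring.ideal_chain_is_trivial[OF noeth False] by blast
      moreover have "C \<subseteq> S" using C by (auto simp: pred_on.chain_def)
      ultimately show ?thesis by blast
    qed
  qed
  then obtain K where KS: "K \<in> S" and max: "\<And>X. X \<in> S \<Longrightarrow> K \<subseteq> X \<Longrightarrow> X = K" by blast
  have idK: "ideal K R" and satK: "saturation R M K \<subseteq> K" and QK: "Q \<subseteq> K" and "\<not> N \<subseteq> K"
    using KS by (auto simp: S_def)
  interpret K: ideal K R by (rule idK)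
  obtain a where a: "a \<in> N" "a \<notin> K" using \<open>\<not> N \<subseteq> K\<close> by blast
  have aR: "a \<in> carrier R" using a by auto
  note idPa = cgenideal_ideal[OF aR]
  have idKa: "ideal (K <+>\<^bsub>R\<^esub> PIdl a) R" by (rule add_ideals[OF idK idPa])
  \<comment> \<open>Otherwise this saturated ideal would be a larger competitor of \<open>K\<close>.\<close>
  have NL: "N \<subseteq> saturation R M (K <+>\<^bsub>R\<^esub> PIdl a)"
  proof (rule ccontr)
    assume not: "\<not> ?thesis"
    have KL: "K \<subseteq> saturation R M (K <+>\<^bsub>R\<^esub> PIdl a)"
      using subset_set_add(1)[OF idK idPa] subset_saturation[OF M idKa] by blast
    then have "saturation R M (K <+>\<^bsub>R\<^esub> PIdl a) \<in> S"
      using not QK saturation_ideal[OF M idKa] saturation_idem[OF M] by (auto simp: S_def)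
    then have "saturation R M (K <+>\<^bsub>R\<^esub> PIdl a) = K" using max KL by blast
    moreover have "a \<in> saturation R M (K <+>\<^bsub>R\<^esub> PIdl a)"
      using subset_set_add(2)[OF idK idPa] subset_saturation[OF M idKa] cgenideal_self[OF aR]
      by blast
    ultimately show False using a by simp
  qed
  \<comment> \<open>Multiplying the local inclusion \<open>N \<subseteq> K + (a)\<close> by \<open>I\<close> yields \<open>I N \<subseteq> K + I a\<close>, which contains
    \<open>a\<close> locally.\<close>
  define W where "W = K <+>\<^bsub>R\<^esub> (I \<cdot> (PIdl a))"
  note idIPa = ideal_prod_is_ideal[OF I idPa]
  have idW: "ideal W R" unfolding W_def by (rule add_ideals[OF idK idIPa])
  have KW: "K \<subseteq> W" and IW: "I \<cdot> (PIdl a) \<subseteq> W"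
    unfolding W_def using subset_set_add[OF idK idIPa] by auto
  interpret W: ideal W R by (rule idW)
  interpret SW: ideal "saturation R M W" R by (rule saturation_ideal[OF M idW])
  have "I \<cdot> N \<subseteq> saturation R M W"
  proof
    fix x assume "x \<in> I \<cdot> N"
    then show "x \<in> saturation R M W"
    proof (induction rule: ideal_prod.induct)
      case (prod i n)
      then have iR: "i \<in> carrier R" and nR: "n \<in> carrier R" by auto
      have "n \<in> saturation R M (K <+>\<^bsub>R\<^esub> PIdl a)" using NL prod(2) by blast
      then obtain s k j
        where s: "s \<in> carrier R - M" "s \<otimes> n = k \<oplus> j" "k \<in> K" "j \<in> PIdl a"
        unfolding saturation_def set_add_def' by blast
      have jR: "j \<in> carrier R" using s(4) ideal.Icarr[OF idPa] by auto
      have "s \<otimes> (i \<otimes> n) = i \<otimes> (k \<oplus> j)" using s iR nR by (simp add: m_ac flip: s(2))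
      also have "\<dots> = i \<otimes> k \<oplus> i \<otimes> j" using iR s jR by (simp add: r_distr)
      also have "\<dots> \<in> W"
        using K.I_l_closed[OF s(3) iR] ideal_prod.prod[OF prod(1) s(4), of R] KW IW
        by (intro W.a_closed) auto
      finally have "s \<otimes> (i \<otimes> n) \<in> W" .
      moreover have "i \<otimes> n \<in> carrier R" using iR nR by simp
      ultimately show ?case unfolding saturation_def using s(1) by blast
    next
      case (sum x y)
      then show ?case by simp
    qed
  qed
  moreover have "Q \<subseteq> saturation R M W" using QK KW subset_saturation[OF M idW] by blast
  ultimately have "(I \<cdot> N) <+>\<^bsub>R\<^esub> Q \<subseteq> saturation R M W"
    by (rule set_add_subset_ideal[OF SW.is_ideal])
  then have "a \<in> saturation R M W"
    using NS a(1) saturation_mono[of _ _ M] saturation_idem[OF M, of W] by (meson in_mono)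
  then obtain s k w where s: "s \<in> carrier R - M" "s \<otimes> a = k \<oplus> w" "k \<in> K" "w \<in> I \<cdot> (PIdl a)"
    unfolding saturation_def W_def set_add_def' by blast
  then obtain i where i: "i \<in> I" "w = i \<otimes> a" using ideal_prod_cgenideal[OF I aR] by blast
  have iR: "i \<in> carrier R" using i by auto
  have "(s \<ominus> i) \<otimes> a = (s \<otimes> a) \<ominus> i \<otimes> a"
    using s iR aR by (simp add: minus_eq l_distr l_minus)
  also have "\<dots> = k" unfolding s(2) i(2) using s iR aR by (simp add: minus_eq a_assoc r_neg)
  finally have "(s \<ominus> i) \<otimes> a \<in> K" using s by simp
  moreover have "s \<ominus> i \<notin> M"
  proof
    assume "s \<ominus> i \<in> M"
    then have "(s \<ominus> i) \<oplus> i \<in> M" using i IM by (auto intro: M.a_closed)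
    moreover have "(s \<ominus> i) \<oplus> i = s" using s iR by (simp add: minus_eq a_assoc l_neg)
    ultimately show False using s by simp
  qed
  moreover have "s \<ominus> i \<in> carrier R" using s(1) iR by simp
  ultimately have "a \<in> saturation R M K" using aR unfolding saturation_def by blast
  then show False using satK a by auto
qed

section \<open>Invertible ideals with two generators\<close>

lemma nonzerodivisors_one: "\<one> \<in> nonzerodivisors R"
  by (auto simp: nonzerodivisors_def)

lemma nonzerodivisors_carr [simp]: "s \<in> nonzerodivisors R \<Longrightarrow> s \<in> carrier R"
  by (auto simp: nonzerodivisors_def)

lemma nonzerodivisorsD:
  "s \<in> nonzerodivisors R \<Longrightarrow> x \<in> carrier R \<Longrightarrow> s \<otimes> x = \<zero> \<Longrightarrow> x = \<zero>"
  unfolding nonzerodivisors_def by blast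

lemma nonzerodivisors_mult_closed:
  assumes s: "s \<in> nonzerodivisors R" and t: "t \<in> nonzerodivisors R"
  shows "s \<otimes> t \<in> nonzerodivisors R"
proof -
  have "x = \<zero>" if x: "x \<in> carrier R" "s \<otimes> t \<otimes> x = \<zero>" for x
  proof -
    have "s \<otimes> (t \<otimes> x) = \<zero>"
      using x m_assoc[of s t x] nonzerodivisors_carr[OF s] nonzerodivisors_carr[OF t] by simp
    then have "t \<otimes> x = \<zero>" using nonzerodivisorsD[OF s] t x(1) by simp
    then show ?thesis using nonzerodivisorsD[OF t] x(1) by simp
  qed
  then show ?thesis unfolding nonzerodivisors_def using s t by simp
qed

lemma nonzerodivisors_cancel:
  assumes s: "s \<in> nonzerodivisors R" and x: "x \<in> carrier R" and y: "y \<in> carrier R"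
    and eq: "s \<otimes> x = s \<otimes> y"
  shows "x = y"
proof -
  have sR: "s \<in> carrier R" using s by simp
  have "s \<otimes> (x \<ominus> y) = s \<otimes> x \<ominus> s \<otimes> y" using sR x y by (simp add: minus_eq r_distr r_minus)
  also have "\<dots> = \<zero>" using sR y eq by simp
  finally have "x \<ominus> y = \<zero>" using nonzerodivisorsD[OF s] x y by simp
  then show ?thesis using x y by simp
qed

lemma mem_fraction_iff:
  "(b, t) \<in> fraction R a s \<longleftrightarrow> a \<in> carrier R \<and> s \<in> nonzerodivisors R \<and>
     b \<in> carrier R \<and> t \<in> nonzerodivisors R \<and> a \<otimes> t = b \<otimes> s"
  by (auto simp: fraction_def fraction_rel_def)

lemma cross_mult_trans:
  assumes "a \<in> carrier R" "b \<in> carrier R" "c \<in> carrier R"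
    and "s \<in> nonzerodivisors R" "t \<in> nonzerodivisors R" "u \<in> nonzerodivisors R"
    and 1: "a \<otimes> t = b \<otimes> s" and 2: "b \<otimes> u = c \<otimes> t"
  shows "a \<otimes> u = c \<otimes> s"
proof (rule nonzerodivisors_cancel[of t])
  have "t \<otimes> (a \<otimes> u) = a \<otimes> t \<otimes> u" using assms(1-6) by (simp add: m_ac)
  also have "\<dots> = b \<otimes> u \<otimes> s" unfolding 1 using assms(1-6) by (simp add: m_ac)
  also have "\<dots> = t \<otimes> (c \<otimes> s)" unfolding 2 using assms(1-6) by (simp add: m_ac)
  finally show "t \<otimes> (a \<otimes> u) = t \<otimes> (c \<otimes> s)" .
qed (use assms in auto)

lemma fraction_eq_iff:
  assumes "a \<in> carrier R" "b \<in> carrier R" "s \<in> nonzerodivisors R" "t \<in> nonzerodivisors R"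
  shows "fraction R a s = fraction R b t \<longleftrightarrow> a \<otimes> t = b \<otimes> s"
proof
  assume "fraction R a s = fraction R b t"
  moreover have "(b, t) \<in> fraction R b t" using assms by (auto simp: mem_fraction_iff)
  ultimately show "a \<otimes> t = b \<otimes> s" by (metis mem_fraction_iff)
next
  assume eq: "a \<otimes> t = b \<otimes> s"
  have "a \<otimes> u = c \<otimes> s \<longleftrightarrow> b \<otimes> u = c \<otimes> t" if "c \<in> carrier R" "u \<in> nonzerodivisors R" for c u
    using cross_mult_trans[OF assms(2,1) that(1) assms(4,3) that(2) eq[symmetric]]
      cross_mult_trans[OF assms(1,2) that(1) assms(3,4) that(2) eq] by blast
  then have "(c, u) \<in> fraction R a s \<longleftrightarrow> (c, u) \<in> fraction R b t" for c u
    unfolding mem_fraction_iff using assms by blast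
  then show "fraction R a s = fraction R b t" by (intro equalityI subrelI) blast+
qed

text \<open>
  The operations on fractions are unions over all representatives; this reduces their evaluation
  to independence of the representatives.
\<close>

lemma UN_pair_const:
  assumes "(a, s) \<in> U" "(b, t) \<in> V"
    and "\<And>a' s' b' t'. (a', s') \<in> U \<Longrightarrow> (b', t') \<in> V \<Longrightarrow> f a' s' b' t' = c"
  shows "(\<Union>(a, s)\<in>U. \<Union>(b, t)\<in>V. f a s b t) = c"
proof
  show "(\<Union>(a, s)\<in>U. \<Union>(b, t)\<in>V. f a s b t) \<subseteq> c" using assms(3) by blast
  show "c \<subseteq> (\<Union>(a, s)\<in>U. \<Union>(b, t)\<in>V. f a s b t)" using assms by fastforce
qed

lemma total_fractions_mult:
  assumes "a \<in> carrier R" "b \<in> carrier R" "s \<in> nonzerodivisors R" "t \<in> nonzerodivisors R"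
  shows "fraction R a s \<otimes>\<^bsub>total_fractions R\<^esub> fraction R b t = fraction R (a \<otimes> b) (s \<otimes> t)"
proof -
  have "fraction R (a' \<otimes> b') (s' \<otimes> t') = fraction R (a \<otimes> b) (s \<otimes> t)"
    if "(a', s') \<in> fraction R a s" "(b', t') \<in> fraction R b t" for a' s' b' t'
  proof -
    have c: "a' \<in> carrier R" "b' \<in> carrier R" "s' \<in> nonzerodivisors R" "t' \<in> nonzerodivisors R"
      and e: "a \<otimes> s' = a' \<otimes> s" "b \<otimes> t' = b' \<otimes> t" using that by (auto simp: mem_fraction_iff)
    have "a' \<otimes> b' \<otimes> (s \<otimes> t) = (a' \<otimes> s) \<otimes> (b' \<otimes> t)" using assms c by (simp add: m_ac)
    also have "\<dots> = a \<otimes> b \<otimes> (s' \<otimes> t')" unfolding e[symmetric] using assms c by (simp add: m_ac)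
    finally show ?thesis using assms c by (simp add: fraction_eq_iff nonzerodivisors_mult_closed)
  qed
  from UN_pair_const[where U = "fraction R a s" and V = "fraction R b t" and a = a and s = s and b = b and t = t
      and f = "\<lambda>a s b t. fraction R (a \<otimes> b) (s \<otimes> t)", OF _ _ this]
    show ?thesis
    using assms by (simp add: total_fractions_def mem_fraction_iff)
qed

lemma total_fractions_add:
  assumes "a \<in> carrier R" "b \<in> carrier R" "s \<in> nonzerodivisors R" "t \<in> nonzerodivisors R"
  shows "fraction R a s \<oplus>\<^bsub>total_fractions R\<^esub> fraction R b t
    = fraction R (a \<otimes> t \<oplus> b \<otimes> s) (s \<otimes> t)"
proof -
  have "fraction R (a' \<otimes> t' \<oplus> b' \<otimes> s') (s' \<otimes> t') = fraction R (a \<otimes> t \<oplus> b \<otimes> s) (s \<otimes> t)"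
    if "(a', s') \<in> fraction R a s" "(b', t') \<in> fraction R b t" for a' s' b' t'
  proof -
    have c: "a' \<in> carrier R" "b' \<in> carrier R" "s' \<in> nonzerodivisors R" "t' \<in> nonzerodivisors R"
      and e: "a \<otimes> s' = a' \<otimes> s" "b \<otimes> t' = b' \<otimes> t" using that by (auto simp: mem_fraction_iff)
    have "(a' \<otimes> t' \<oplus> b' \<otimes> s') \<otimes> (s \<otimes> t) = (a' \<otimes> s) \<otimes> (t \<otimes> t') \<oplus> (b' \<otimes> t) \<otimes> (s \<otimes> s')"
      using assms c by (simp add: m_ac l_distr r_distr)
    also have "\<dots> = (a \<otimes> t \<oplus> b \<otimes> s) \<otimes> (s' \<otimes> t')"
      unfolding e[symmetric] using assms c by (simp add: m_ac l_distr r_distr)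
    finally show ?thesis using assms c by (simp add: fraction_eq_iff nonzerodivisors_mult_closed)
  qed
  from UN_pair_const[where U = "fraction R a s" and V = "fraction R b t" and a = a and s = s and b = b and t = t
      and f = "\<lambda>a s b t. fraction R (a \<otimes> t \<oplus> b \<otimes> s) (s \<otimes> t)", OF _ _ this]
    show ?thesis
    using assms by (simp add: total_fractions_def mem_fraction_iff)
qed

lemma total_fractions_smult:
  assumes "r \<in> carrier R" "a \<in> carrier R" "s \<in> nonzerodivisors R"
  shows "r \<odot>\<^bsub>total_fractions R\<^esub> fraction R a s = fraction R (r \<otimes> a) s"
proof -
  have "fraction R (r \<otimes> a') s' = fraction R (r \<otimes> a) s" if "(a', s') \<in> fraction R a s" for a' s'
    using that assms by (auto simp: mem_fraction_iff fraction_eq_iff m_assoc)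
  moreover have "(a, s) \<in> fraction R a s" using assms by (simp add: mem_fraction_iff)
  ultimately have "(\<Union>(a, s)\<in>fraction R a s. fraction R (r \<otimes> a) s) = fraction R (r \<otimes> a) s"
    by blast
  then show ?thesis by (simp add: total_fractions_def)
qed

lemma total_fractions_cases:
  assumes "z \<in> carrier (total_fractions R)"
  obtains a s where "a \<in> carrier R" "s \<in> nonzerodivisors R" "z = fraction R a s"
  using assms by (auto simp: total_fractions_def fraction_def elim!: quotientE)

lemma Idl_pair_elem:
  assumes p: "p \<in> carrier R" and b: "b \<in> carrier R" and x: "x \<in> Idl {p, b}"
  obtains r q where "r \<in> carrier R" "q \<in> carrier R" "x = r \<otimes> p \<oplus> q \<otimes> b"
proof -
  have "{p, b} \<subseteq> PIdl p <+>\<^bsub>R\<^esub> PIdl b"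
    using subset_set_add[OF cgenideal_ideal[OF p] cgenideal_ideal[OF b]]
      cgenideal_self[OF p] cgenideal_self[OF b] by blast
  then have "Idl {p, b} \<subseteq> PIdl p <+>\<^bsub>R\<^esub> PIdl b"
    by (rule genideal_minimal[OF add_ideals[OF cgenideal_ideal[OF p] cgenideal_ideal[OF b]]])
  with x have "x \<in> PIdl p <+>\<^bsub>R\<^esub> PIdl b" by blast
  then show ?thesis using that by (auto simp: set_add_def' cgenideal_def)
qed

text \<open>
  An inverse \<open>J\<close> of \<open>(p, b)\<close> yields \<open>1 = p x + b y\<close> with \<open>x, y \<in> J\<close>, and the elements \<open>t = p x\<close>,
  \<open>s = b y\<close>, \<open>c = p y\<close>, \<open>d = b x\<close> all lie in \<open>R\<close>. In a local ring one of \<open>s\<close> and \<open>t\<close> is a unit,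
  and the equations then say that one generator divides the other.
\<close>

lemma invertible_pair:
  assumes p: "p \<in> carrier R" and b: "b \<in> carrier R" and inv: "invertible_ideal (Idl {p, b}) R"
  obtains s t c d where "s \<in> carrier R" "t \<in> carrier R" "c \<in> carrier R" "d \<in> carrier R"
    "s \<oplus> t = \<one>" "s \<otimes> p = b \<otimes> c" "t \<otimes> b = p \<otimes> d"
proof -
  let ?T = "total_fractions R"
  obtain J where J: "submodule J R ?T"
    and prod: "(fraction_embed R ` (Idl {p, b})) \<cdot>\<^bsub>?T\<^esub> J = fraction_embed R ` carrier R"
    using inv by (auto simp: invertible_ideal_def)
  interpret J: submodule J R ?T by (rule J)
  have Jadd: "x \<oplus>\<^bsub>?T\<^esub> y \<in> J" if "x \<in> J" "y \<in> J" for x y using J.m_closed[OF that] by simp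
  have Jcarr: "x \<in> carrier ?T" if "x \<in> J" for x using J.subset that by auto
  \<comment> \<open>Every element of the product is \<open>p x + b y\<close> with \<open>x, y \<in> J\<close>; the fractions \<open>x = u / w\<close> and
    \<open>y = v / w\<close> are kept over a common denominator, which turns the identities to be shown
    into identities between elements of \<open>R\<close>.\<close>
  have form: "\<exists>u v w. u \<in> carrier R \<and> v \<in> carrier R \<and> w \<in> nonzerodivisors R \<and>
      fraction R u w \<in> J \<and> fraction R v w \<in> J \<and> z = fraction R (p \<otimes> u \<oplus> b \<otimes> v) w"
    if "z \<in> (fraction_embed R ` (Idl {p, b})) \<cdot>\<^bsub>?T\<^esub> J" for z
    using that
  proof (induction rule: ideal_prod.induct)
    case (prod x j)
    obtain i where i: "i \<in> Idl {p, b}" "x = fraction R i \<one>"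
      using prod by (auto simp: fraction_embed_def)
    obtain r q where r: "r \<in> carrier R" "q \<in> carrier R" "i = r \<otimes> p \<oplus> q \<otimes> b"
      using Idl_pair_elem[OF p b i(1)] by blast
    obtain a w where a: "a \<in> carrier R" "w \<in> nonzerodivisors R" "j = fraction R a w"
      using total_fractions_cases[OF Jcarr[OF prod(2)]] by blast
    have "fraction R (r \<otimes> a) w \<in> J" "fraction R (q \<otimes> a) w \<in> J"
      using J.smult_closed[OF r(1) prod(2)] J.smult_closed[OF r(2) prod(2)] a r
      by (simp_all add: total_fractions_smult)
    moreover have "x \<otimes>\<^bsub>?T\<^esub> j = fraction R (p \<otimes> (r \<otimes> a) \<oplus> b \<otimes> (q \<otimes> a)) w"
      using a r p b by (simp add: i(2) total_fractions_mult nonzerodivisors_one l_distr r_distr m_ac)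
    ultimately show ?case using a r by (meson m_closed)
  next
    case (sum x y)
    obtain u v w where 1: "u \<in> carrier R" "v \<in> carrier R" "w \<in> nonzerodivisors R"
      "fraction R u w \<in> J" "fraction R v w \<in> J" "x = fraction R (p \<otimes> u \<oplus> b \<otimes> v) w"
      using sum by blast
    obtain u' v' w' where 2: "u' \<in> carrier R" "v' \<in> carrier R" "w' \<in> nonzerodivisors R"
      "fraction R u' w' \<in> J" "fraction R v' w' \<in> J" "y = fraction R (p \<otimes> u' \<oplus> b \<otimes> v') w'"
      using sum by blast
    have "fraction R (u \<otimes> w' \<oplus> u' \<otimes> w) (w \<otimes> w') \<in> J"
      using Jadd[OF 1(4) 2(4)] 1(1-3) 2(1-3) by (simp add: total_fractions_add)
    moreover have "fraction R (v \<otimes> w' \<oplus> v' \<otimes> w) (w \<otimes> w') \<in> J"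
      using Jadd[OF 1(5) 2(5)] 1(1-3) 2(1-3) by (simp add: total_fractions_add)
    moreover have "(p \<otimes> u \<oplus> b \<otimes> v) \<otimes> w' \<oplus> (p \<otimes> u' \<oplus> b \<otimes> v') \<otimes> w
        = p \<otimes> (u \<otimes> w' \<oplus> u' \<otimes> w) \<oplus> b \<otimes> (v \<otimes> w' \<oplus> v' \<otimes> w)"
      using 1(1-3) 2(1-3) p b by (simp add: l_distr r_distr m_ac a_ac)
    then have "x \<oplus>\<^bsub>?T\<^esub> y
        = fraction R (p \<otimes> (u \<otimes> w' \<oplus> u' \<otimes> w) \<oplus> b \<otimes> (v \<otimes> w' \<oplus> v' \<otimes> w)) (w \<otimes> w')"
      using 1(1-3) 2(1-3) p b by (simp add: 1(6) 2(6) total_fractions_add)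
    moreover have "w \<otimes> w' \<in> nonzerodivisors R" using 1(3) 2(3) by (rule nonzerodivisors_mult_closed)
    moreover have "u \<otimes> w' \<oplus> u' \<otimes> w \<in> carrier R" "v \<otimes> w' \<oplus> v' \<otimes> w \<in> carrier R"
      using 1(1-3) 2(1-3) by auto
    ultimately show ?case by blast
  qed
  have "fraction R \<one> \<one> \<in> (fraction_embed R ` (Idl {p, b})) \<cdot>\<^bsub>?T\<^esub> J"
    unfolding prod by (auto simp: fraction_embed_def)
  then obtain u v w where u: "u \<in> carrier R" and v: "v \<in> carrier R" and w: "w \<in> nonzerodivisors R"
    and uJ: "fraction R u w \<in> J" and vJ: "fraction R v w \<in> J"
    and one: "fraction R \<one> \<one> = fraction R (p \<otimes> u \<oplus> b \<otimes> v) w"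
    using form by meson
  have wR: "w \<in> carrier R" using w by simp
  have w_eq: "w = p \<otimes> u \<oplus> b \<otimes> v"
    using one u v w p b by (simp add: fraction_eq_iff nonzerodivisors_one)
  have mult: "\<exists>c\<in>carrier R. i \<otimes> x = c \<otimes> w"
    if i: "i \<in> {p, b}" and x: "x \<in> carrier R" "fraction R x w \<in> J" for i x
  proof -
    have iR: "i \<in> carrier R" using i p b by auto
    have "i \<in> Idl {p, b}" using genideal_self[of "{p, b}"] p b i by blast
    then have "fraction R i \<one> \<otimes>\<^bsub>?T\<^esub> fraction R x w \<in> fraction_embed R ` carrier R"
      unfolding prod[symmetric] using x by (auto simp: fraction_embed_def intro!: ideal_prod.prod)
    then obtain c where "c \<in> carrier R" "fraction R (i \<otimes> x) w = fraction R c \<one>"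
      using iR x w by (auto simp: total_fractions_mult nonzerodivisors_one fraction_embed_def)
    then show ?thesis using iR x w by (auto simp: fraction_eq_iff nonzerodivisors_one)
  qed
  obtain t where t: "t \<in> carrier R" "p \<otimes> u = t \<otimes> w" using mult[of p u] u uJ by auto
  obtain s where s: "s \<in> carrier R" "b \<otimes> v = s \<otimes> w" using mult[of b v] v vJ by auto
  obtain c where c: "c \<in> carrier R" "p \<otimes> v = c \<otimes> w" using mult[of p v] v vJ by auto
  obtain d where d: "d \<in> carrier R" "b \<otimes> u = d \<otimes> w" using mult[of b u] u uJ by auto
  have "w \<otimes> (s \<oplus> t) = w \<otimes> \<one>"
  proof -
    have "w \<otimes> (s \<oplus> t) = t \<otimes> w \<oplus> s \<otimes> w" using s t wR by (simp add: r_distr m_ac a_ac)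
    also have "\<dots> = w" using w_eq s t by simp
    finally show ?thesis using wR by simp
  qed
  then have 1: "s \<oplus> t = \<one>" using nonzerodivisors_cancel[OF w] s t by simp
  have "w \<otimes> (s \<otimes> p) = w \<otimes> (b \<otimes> c)"
  proof -
    have "w \<otimes> (s \<otimes> p) = p \<otimes> (s \<otimes> w)" using s p wR by (simp add: m_ac)
    also have "\<dots> = b \<otimes> (p \<otimes> v)" unfolding s(2)[symmetric] using p b v by (simp add: m_ac)
    also have "\<dots> = w \<otimes> (b \<otimes> c)" unfolding c(2) using b c wR by (simp add: m_ac)
    finally show ?thesis .
  qed
  then have 2: "s \<otimes> p = b \<otimes> c" using nonzerodivisors_cancel[OF w] s p b c by simp
  have "w \<otimes> (t \<otimes> b) = w \<otimes> (p \<otimes> d)"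
  proof -
    have "w \<otimes> (t \<otimes> b) = b \<otimes> (t \<otimes> w)" using t b wR by (simp add: m_ac)
    also have "\<dots> = p \<otimes> (b \<otimes> u)" unfolding t(2)[symmetric] using p b u by (simp add: m_ac)
    also have "\<dots> = w \<otimes> (p \<otimes> d)" unfolding d(2) using p d wR by (simp add: m_ac)
    finally show ?thesis .
  qed
  then have 3: "t \<otimes> b = p \<otimes> d" using nonzerodivisors_cancel[OF w] t p b d by simp
  show thesis by (rule that[OF s(1) t(1) c(1) d(1) 1 2 3])
qed

section \<open>Chains of primes\<close>

text \<open>The equations of the previous lemma, lifted from the quotient by \<open>Q\<close> to \<open>R\<close>.\<close>

lemma pruefer_quotient_two_generators:
  assumes Q: "ideal Q R" and A: "pruefer_ring (R Quot Q)"
    and p: "p \<in> carrier R" and b: "b \<in> carrier R"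
    and reg: "\<And>x. x \<in> carrier R \<Longrightarrow> b \<otimes> x \<in> Q \<Longrightarrow> x \<in> Q"
  obtains s t c d where "s \<in> carrier R" "t \<in> carrier R" "c \<in> carrier R" "d \<in> carrier R"
    "(s \<oplus> t) \<ominus> \<one> \<in> Q" "s \<otimes> p \<ominus> b \<otimes> c \<in> Q" "t \<otimes> b \<ominus> p \<otimes> d \<in> Q"
proof -
  let ?A = "R Quot Q"
  interpret Q: ideal Q R by (rule Q)
  interpret A: pruefer_ring ?A by (rule A)
  interpret h: ring_hom_ring R ?A "(+>) Q" by (rule Q.rcos_ring_hom_ring)
  have surj: "\<exists>x\<in>carrier R. X = Q +> x" if "X \<in> carrier ?A" for X
  proof -
    have "X \<in> a_rcosets Q" using that unfolding FactRing_def by (simp only: partial_object.simps)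
    then show ?thesis unfolding A_RCOSETS_def' by blast
  qed
  have eq: "Q +> x = Q +> y \<longleftrightarrow> x \<ominus> y \<in> Q" if "x \<in> carrier R" "y \<in> carrier R" for x y
    using quotient_eq_iff_same_a_r_cos[OF Q that] by simp
  have zero: "Q +> x = \<zero>\<^bsub>?A\<^esub> \<longleftrightarrow> x \<in> Q" if "x \<in> carrier R" for x
    using Q.a_rcos_const[of x] Q.a_rcos_self[OF that] unfolding FactRing_def by auto
  have pA: "Q +> p \<in> carrier ?A" and bA: "Q +> b \<in> carrier ?A" using p b by auto
  have "Q +> b \<in> nonzerodivisors ?A"
  proof -
    have "X = \<zero>\<^bsub>?A\<^esub>" if X: "X \<in> carrier ?A" "(Q +> b) \<otimes>\<^bsub>?A\<^esub> X = \<zero>\<^bsub>?A\<^esub>" for X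
    proof -
      obtain x where x: "x \<in> carrier R" "X = Q +> x" using surj X by blast
      then have "Q +> (b \<otimes> x) = \<zero>\<^bsub>?A\<^esub>" using X(2) h.hom_mult[OF b] by metis
      then show ?thesis using zero reg x b m_closed by metis
    qed
    then show ?thesis unfolding nonzerodivisors_def using bA by blast
  qed
  moreover have gen: "{Q +> p, Q +> b} \<subseteq> carrier ?A" using pA bA by auto
  ultimately have "regular_ideal (Idl\<^bsub>?A\<^esub> {Q +> p, Q +> b}) ?A"
    using A.genideal_ideal[OF gen] A.genideal_self[OF gen] by (auto simp: regular_ideal_def)
  moreover have "fin_gen_ideal (Idl\<^bsub>?A\<^esub> {Q +> p, Q +> b}) ?A"
    unfolding fin_gen_ideal_def using gen by blast
  ultimately have "invertible_ideal (Idl\<^bsub>?A\<^esub> {Q +> p, Q +> b}) ?A"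
    using A.fin_gen_regular_invertible by blast
  from A.invertible_pair[OF pA bA this] obtain S T C D where
    ST: "S \<in> carrier ?A" "T \<in> carrier ?A" "C \<in> carrier ?A" "D \<in> carrier ?A"
    "S \<oplus>\<^bsub>?A\<^esub> T = \<one>\<^bsub>?A\<^esub>" "S \<otimes>\<^bsub>?A\<^esub> (Q +> p) = (Q +> b) \<otimes>\<^bsub>?A\<^esub> C"
    "T \<otimes>\<^bsub>?A\<^esub> (Q +> b) = (Q +> p) \<otimes>\<^bsub>?A\<^esub> D" .
  obtain s t c d where st: "s \<in> carrier R" "t \<in> carrier R" "c \<in> carrier R" "d \<in> carrier R"
    "S = Q +> s" "T = Q +> t" "C = Q +> c" "D = Q +> d"
    using surj ST(1-4) by meson
  have "Q +> (s \<oplus> t) = Q +> \<one>" using ST(5) st by simp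
  then have 1: "(s \<oplus> t) \<ominus> \<one> \<in> Q" using eq st(1,2) by blast
  have "Q +> (s \<otimes> p) = Q +> (b \<otimes> c)" using ST(6) st p b by simp
  then have 2: "s \<otimes> p \<ominus> b \<otimes> c \<in> Q" using eq st(1,3) p b by blast
  have "Q +> (t \<otimes> b) = Q +> (p \<otimes> d)" using ST(7) st p b by simp
  then have 3: "t \<otimes> b \<ominus> p \<otimes> d \<in> Q" using eq st(2,4) p b by blast
  show ?thesis by (rule that[OF st(1-4) 1 2 3])
qed

text \<open>
  Modulo \<open>Q\<close> and locally at \<open>M\<close>, every \<open>p \<in> P\<close> is divisible by a fixed \<open>b \<in> M - P\<close> with quotient in
  the prime \<open>P\<close>, so Nakayama's lemma applies to \<open>P\<close> modulo \<open>Q\<close>.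
\<close>

lemma pruefer_mod_symbolic_square:
  assumes noeth: "noetherian_ring R" and P: "primeideal P R" and M: "primeideal M R"
    and PM: "P \<subset> M" and A: "pruefer_ring (R Quot (saturation R P (P \<cdot> P)))"
  shows "P \<subseteq> saturation R P (P \<cdot> P)"
proof -
  interpret P: primeideal P R by (rule P)
  interpret M: primeideal M R by (rule M)
  define Q where "Q = saturation R P (P \<cdot> P)"
  have Q: "ideal Q R"
    unfolding Q_def by (rule saturation_ideal[OF P ideal_prod_is_ideal[OF P.is_ideal P.is_ideal]])
  interpret Q: ideal Q R by (rule Q)
  have QP: "Q \<subseteq> P"
    unfolding Q_def by (rule symbolic_square_subset[OF P])
  have satQ: "saturation R P Q \<subseteq> Q" unfolding Q_def by (rule saturation_idem[OF P])
  obtain b where b: "b \<in> M" "b \<notin> P" using PM by blast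
  have bR: "b \<in> carrier R" using b by auto
  have reg: "x \<in> Q" if "x \<in> carrier R" "b \<otimes> x \<in> Q" for x
    using satQ that b bR unfolding saturation_def by blast
  note idMP = ideal_prod_is_ideal[OF M.is_ideal P.is_ideal]
  have "P \<subseteq> saturation R M ((M \<cdot> P) <+>\<^bsub>R\<^esub> Q)"
  proof
    fix p assume p: "p \<in> P"
    have pR: "p \<in> carrier R" using p by auto
    obtain s t c d where st: "s \<in> carrier R" "t \<in> carrier R" "c \<in> carrier R" "d \<in> carrier R"
      "(s \<oplus> t) \<ominus> \<one> \<in> Q" "s \<otimes> p \<ominus> b \<otimes> c \<in> Q" "t \<otimes> b \<ominus> p \<otimes> d \<in> Q"
      using pruefer_quotient_two_generators[OF Q A[folded Q_def] pR bR reg] .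
    have cancel: "y \<oplus> (x \<ominus> y) = x" if "x \<in> carrier R" "y \<in> carrier R" for x y
      using that by (simp add: minus_eq a_ac r_neg1 r_neg2 r_neg)
    have cancel2: "x \<ominus> (x \<ominus> y) = y" if "x \<in> carrier R" "y \<in> carrier R" for x y
      using that by (simp add: minus_eq minus_add r_neg2)
    \<comment> \<open>Locally at \<open>M\<close>, \<open>p\<close> does not divide \<open>b\<close>: its cofactor \<open>t\<close> lies in \<open>P\<close>, so \<open>s\<close>, which is
      congruent to \<open>1 - t\<close>, is a unit.\<close>
    have "p \<otimes> d \<oplus> (t \<otimes> b \<ominus> p \<otimes> d) \<in> P"
      using st QP p by (intro P.a_closed P.I_r_closed) auto
    then have "t \<otimes> b \<in> P" using cancel st pR bR by simp
    then have tM: "t \<in> M" using P.I_prime[of t b] b bR st PM by auto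
    have sM: "s \<notin> M"
    proof
      assume "s \<in> M"
      then have 1: "s \<oplus> t \<in> M" using tM by simp
      have "(s \<oplus> t) \<ominus> ((s \<oplus> t) \<ominus> \<one>) \<in> M"
        using M.a_closed[OF 1 M.a_inv_closed[of "(s \<oplus> t) \<ominus> \<one>"]] st(5) QP PM
        by (auto simp: minus_eq[of "s \<oplus> t" "(s \<oplus> t) \<ominus> \<one>"])
      moreover have "(s \<oplus> t) \<ominus> ((s \<oplus> t) \<ominus> \<one>) = \<one>"
        using cancel2 st(1,2) by simp
      ultimately show False using M.one_imp_carrier M.I_notcarr by simp
    qed
    \<comment> \<open>Hence \<open>b\<close> divides \<open>p\<close> locally, with quotient \<open>c\<close> in \<open>P\<close>.\<close>
    have "s \<otimes> p \<ominus> (s \<otimes> p \<ominus> b \<otimes> c) \<in> P"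
      unfolding minus_eq[of "s \<otimes> p" "s \<otimes> p \<ominus> b \<otimes> c"] using st QP p
      by (intro P.a_closed P.a_inv_closed P.I_l_closed) auto
    moreover have "s \<otimes> p \<ominus> (s \<otimes> p \<ominus> b \<otimes> c) = b \<otimes> c"
      using cancel2 st(1,3) pR bR by simp
    ultimately have "b \<otimes> c \<in> P" by simp
    then have "c \<in> P" using P.I_prime bR st(3) b by blast
    then have "b \<otimes> c \<in> M \<cdot> P" using b by (intro ideal_prod.prod)
    then have "b \<otimes> c \<oplus> (s \<otimes> p \<ominus> b \<otimes> c) \<in> (M \<cdot> P) <+>\<^bsub>R\<^esub> Q"
      using st(6) by (auto simp: set_add_def')
    then have "s \<otimes> p \<in> (M \<cdot> P) <+>\<^bsub>R\<^esub> Q" using cancel st pR bR by simp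
    then show "p \<in> saturation R M ((M \<cdot> P) <+>\<^bsub>R\<^esub> Q)"
      using pR st sM by (auto simp: saturation_def)
  qed
  then have "P \<subseteq> saturation R M Q"
    using local_nakayama[OF noeth M M.is_ideal P.is_ideal Q] by blast
  also have "\<dots> \<subseteq> saturation R P Q" using PM by (auto simp: saturation_def)
  also have "\<dots> \<subseteq> Q" by (rule satQ)
  finally show ?thesis by (simp add: Q_def)
qed

text \<open>
  By Nakayama's lemma at \<open>P\<close>, applied modulo \<open>P0\<close>, each element of \<open>P\<close> is moved into \<open>P0\<close> by a factor
  outside \<open>P\<close>, and hence lies in the prime \<open>P0\<close> itself.
\<close>

lemma symbolic_square_imp_minimal_prime:
  assumes noeth: "noetherian_ring R" and P: "primeideal P R" and P0: "primeideal P0 R"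
    and "P0 \<subseteq> P" and PS: "P \<subseteq> saturation R P (P \<cdot> P)"
  shows "P \<subseteq> P0"
proof -
  interpret P: primeideal P R by (rule P)
  interpret P0: primeideal P0 R by (rule P0)
  note idPP = ideal_prod_is_ideal[OF P.is_ideal P.is_ideal]
  have "P \<subseteq> saturation R P ((P \<cdot> P) <+>\<^bsub>R\<^esub> P0)"
    using PS saturation_mono[OF subset_set_add(1)[OF idPP P0.is_ideal]] by blast
  then have "P \<subseteq> saturation R P P0"
    by (rule local_nakayama[OF noeth P P.is_ideal P.is_ideal P0.is_ideal subset_refl])
  then show ?thesis using saturation_primeideal[OF P0] assms(4) by blast
qed

end

lemma (in pre_pruefer_ring) no_chain_of_three_primes:
  assumes noeth: "noetherian_ring R"
    and P0: "primeideal P0 R" and P: "primeideal P R" and M: "primeideal M R"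
    and P0P: "P0 \<subset> P" and PM: "P \<subset> M"
  shows False
proof -
  interpret P0: primeideal P0 R by (rule P0)
  interpret P: primeideal P R by (rule P)
  define Q where "Q = saturation R P (P \<cdot> P)"
  note idPP = ideal_prod_is_ideal[OF P.is_ideal P.is_ideal]
  have Q: "ideal Q R" unfolding Q_def by (rule saturation_ideal[OF P idPP])
  have "P \<subseteq> P0"
  proof (cases "Q = {\<zero>}")
    case True
    then have "P \<cdot> P \<subseteq> P0" using subset_saturation[OF P idPP] by (auto simp: Q_def)
    then show ?thesis by (rule ideal_prod_subset_prime[OF P0 P.is_ideal])
  next
    case False
    have "Q \<subseteq> P"
      unfolding Q_def by (rule symbolic_square_subset[OF P])
    then have "Q \<noteq> carrier R" using P.I_notcarr P.a_subset by auto
    then have "pruefer_ring (R Quot Q)" by (rule quotient_pruefer[OF Q False])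
    then have "P \<subseteq> saturation R P (P \<cdot> P)"
      unfolding Q_def by (rule pruefer_mod_symbolic_square[OF noeth P M PM])
    then show ?thesis
      using symbolic_square_imp_minimal_prime[OF noeth P P0] P0P by blast
  qed
  then show False using P0P by blast
qed

theorem proposition4p9:
  fixes R :: "('a, 'b) ring_scheme"
  assumes "noetherian_ring R"
    and "pre_pruefer_ring R"
  shows "krull_dim R \<le> 1"
  unfolding krull_dim_def
proof (rule Sup_least)
  fix x assume "x \<in> {ereal (real n) | n. \<exists>P. (\<forall>i\<le>n. primeideal (P i) R) \<and> (\<forall>i<n. P i \<subset> P (Suc i))}"
  then obtain n P where x: "x = ereal (real n)" and prime: "\<And>i. i \<le> n \<Longrightarrow> primeideal (P i) R"
    and chain: "\<And>i. i < n \<Longrightarrow> P i \<subset> P (Suc i)" by blast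
  have "n \<le> 1"
  proof (rule ccontr)
    assume "\<not> n \<le> 1"
    then show False
      using pre_pruefer_ring.no_chain_of_three_primes[OF assms(2,1) prime[of 0] prime[of 1] prime[of 2]]
        chain[of 0] chain[of 1] by (simp add: numeral_2_eq_2)
  qed
  then show "x \<le> 1" using x by (simp add: one_ereal_def)
qed

end
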